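(* Let $\xi,\xi_1,\xi_2,\ldots$ be independent identically distributed random variables taking values in $\{0,1,2,\ldots\}$ with $\mathbf{P}(\xi=i)=p_i>0$ for all $i\ge 0$, $\sum_{i\ge 0}p_i=1$. Let $\bar\xi_n$, $r(n)$, $a_n$ be as defined in the context, and let $l\ge 1$ be a fixed integer. Suppose that $r(n)$ is a monotonic function, that $r(n)\to\infty$ as $n\to\infty$, and that $$\lim_{n\to\infty}\frac{r(n)}{n}=0.$$ If the series $\sum_{k\ge 1}\exp\big(-\exp((l-1)\,r(k))\big)$ diverges, then $$\mathbf{P}(\bar\xi_n=a_n-l\ \text{ i.o.})=1.$$
   Context: For the i.i.d. sequence $\xi,\xi_1,\xi_2,\ldots$ set $\bar\xi_n=\max_{1\le i\le n}\xi_i$. For the distribution $(i,p_i)$, $i\ge0$, of $\xi$ define $$R(n)=-\ln\mathbf{P}(\xi\ge n)=-\ln\Big(\sum_{i\ge n}p_i\Big),\quad n\ge 0,\qquad r(n)=R(n)-R(n-1),\quad n\ge 1,$$ $$a_n=\max\Big(k\ge 0:\ \sum_{i\ge k}p_i\ge \frac1n\Big).$$ "i.o." means "infinitely often", i.e. the event occurs for infinitely many $n$. *)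

theory Defs
  imports "HOL-Probability.Probability"
begin

definition tail :: "(nat \<Rightarrow> real) \<Rightarrow> nat \<Rightarrow> real" where
  "tail p n = (\<Sum>i. p (n + i))"

definition R :: "(nat \<Rightarrow> real) \<Rightarrow> nat \<Rightarrow> real" where
  "R p n = - ln (tail p n)"

text \<open>Only the values \<open>r p n\<close> with \<open>n \<ge> 1\<close> are meaningful.\<close>

definition r :: "(nat \<Rightarrow> real) \<Rightarrow> nat \<Rightarrow> real" where
  "r p n = R p n - R p (n - 1)"

text \<open>For a probability distribution \<open>p\<close> and \<open>n \<ge> 1\<close> the set below is finite and contains
  \<open>0\<close>; the value at \<open>n = 0\<close> is junk.\<close>

definition a :: "(nat \<Rightarrow> real) \<Rightarrow> nat \<Rightarrow> nat" where
  "a p n = Max {k. tail p k \<ge> 1 / real n}"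

text \<open>The sequence is indexed from \<open>1\<close>; the value at \<open>n = 0\<close> is junk.\<close>

definition running_max :: "(nat \<Rightarrow> 'a \<Rightarrow> nat) \<Rightarrow> nat \<Rightarrow> 'a \<Rightarrow> nat" where
  "running_max \<xi> n \<omega> = Max ((\<lambda>i. \<xi> i \<omega>) ` {1..n})"

end

theory Submission
  imports Defs
begin

text \<open>It suffices to look at the first index \<open>N k\<close> with \<open>a (N k) = k\<close> and the event \<open>A k\<close> that the
  maximum at time \<open>N k\<close> equals \<open>k - l\<close>. Since \<open>r\<close> tends to infinity, \<open>A k\<close> has asymptotically the same
  probability as the event that the maximum is at most \<open>k - l\<close>; by monotonicity of \<open>r\<close> and
  \<open>r n / n \<longlonglongrightarrow> 0\<close> this is at least a constant times \<open>exp (- exp ((l - 1) r k))\<close>, so these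
  probabilities have a divergent sum. For \<open>k \<ge> j + l\<close> the event \<open>A j\<close> is asymptotically irrelevant to
  \<open>A k\<close>, because the first \<open>N j\<close> variables are at most \<open>j \<le> k - l\<close> with probability close to \<open>1\<close>.
  Chebyshev's inequality for the number of events that occur then gives the claim.\<close>

section \<open>A Borel--Cantelli lemma for quasi-independent events\<close>

context prob_space
begin

text \<open>Chebyshev's inequality for the number \<open>X\<close> of events that occur: its mean is
  \<open>s\<close>, the double sum is its second moment, so \<open>c\<close> bounds its variance,
  while \<open>X\<close> deviates from \<open>s\<close> by exactly \<open>s\<close> where no event
  occurs.\<close>

lemma second_moment_avoidance:
  fixes A :: "'b \<Rightarrow> 'a set"
  assumes "finite F" and A: "\<And>k. k \<in> F \<Longrightarrow> A k \<in> events"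
    and s: "s = (\<Sum>k\<in>F. prob (A k))"
    and le: "(\<Sum>j\<in>F. \<Sum>k\<in>F. prob (A j \<inter> A k)) \<le> s\<^sup>2 + c"
  shows "s\<^sup>2 * prob {\<omega> \<in> space M. \<forall>k\<in>F. \<omega> \<notin> A k} \<le> c"
proof -
  define X :: "'a \<Rightarrow> real" where "X \<omega> = (\<Sum>k\<in>F. indicator (A k) \<omega>)" for \<omega>
  define B where "B = {\<omega> \<in> space M. \<forall>k\<in>F. \<omega> \<notin> A k}"
  have B: "B \<in> events"
    unfolding B_def using assms(1) A by measurable
  have int1: "integrable M (\<lambda>\<omega>. indicator (A k) \<omega> :: real)" if "k \<in> F" for k
    using A[OF that] by (simp add: integrable_indicator_iff less_top[symmetric])
  have int2: "integrable M (\<lambda>\<omega>. indicator (A j \<inter> A k) \<omega> :: real)" if "j \<in> F" "k \<in> F" for j k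
    using A[OF that(1)] A[OF that(2)] by (simp add: integrable_indicator_iff less_top[symmetric])
  have X2: "(X \<omega>)\<^sup>2 = (\<Sum>j\<in>F. \<Sum>k\<in>F. indicator (A j \<inter> A k) \<omega>)" for \<omega>
    by (simp add: X_def power2_eq_square sum_product indicator_inter_arith)
  have intX: "integrable M X" unfolding X_def by (intro Bochner_Integration.integrable_sum int1)
  have intX2: "integrable M (\<lambda>\<omega>. (X \<omega>)\<^sup>2)"
    unfolding X2 by (intro Bochner_Integration.integrable_sum int2)
  have EX: "expectation X = s"
    unfolding X_def s using int1 A by (subst Bochner_Integration.integral_sum) auto
  have EX2: "expectation (\<lambda>\<omega>. (X \<omega>)\<^sup>2) = (\<Sum>j\<in>F. \<Sum>k\<in>F. prob (A j \<inter> A k))"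
    unfolding X2 using int2 A
    by (simp add: Bochner_Integration.integral_sum Bochner_Integration.integrable_sum sets.Int)
  have "s\<^sup>2 * prob B = expectation (\<lambda>\<omega>. s\<^sup>2 * indicator B \<omega>)"
    using B by simp
  also have "\<dots> \<le> expectation (\<lambda>\<omega>. (X \<omega> - s)\<^sup>2)"
  proof (rule integral_mono)
    show "integrable M (\<lambda>\<omega>. s\<^sup>2 * indicator B \<omega>)"
      using B by (auto simp: integrable_indicator_iff less_top[symmetric])
    show "integrable M (\<lambda>\<omega>. (X \<omega> - s)\<^sup>2)"
      unfolding power2_diff using intX intX2 by auto
    show "s\<^sup>2 * indicator B \<omega> \<le> (X \<omega> - s)\<^sup>2" for \<omega>
      by (cases "\<omega> \<in> B") (auto simp: B_def X_def)
  qed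
  also have "\<dots> = expectation (\<lambda>\<omega>. (X \<omega>)\<^sup>2) - s\<^sup>2"
    using variance_eq[OF intX intX2] EX by simp
  also have "\<dots> \<le> c" using le EX2 by simp
  finally show ?thesis unfolding B_def .
qed

text \<open>The second moment bound is applied to a long block of indices beyond \<open>K\<close>.
  Pairs at distance at least \<open>l\<close> contribute at most
  \<open>(1 + \<epsilon>) * s\<^sup>2\<close>. The remaining pairs contribute only a multiple of
  \<open>s\<close>, which divergence makes negligible against \<open>s\<^sup>2\<close>.\<close>

lemma quasi_independent_borel_cantelli:
  fixes A :: "nat \<Rightarrow> 'a set" and l :: nat
  assumes A: "\<And>k. A k \<in> events"
    and div: "\<not> summable (\<lambda>k. prob (A k))"
    and quasi: "\<And>\<epsilon>. \<epsilon> > 0 \<Longrightarrow>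
      \<exists>K. \<forall>j\<ge>K. \<forall>k\<ge>j+l. prob (A j \<inter> A k) \<le> (1 + \<epsilon>) * (prob (A j) * prob (A k))"
  shows "AE \<omega> in M. \<exists>\<^sub>\<infinity>k. \<omega> \<in> A k"
proof -
  define B where "B m = {\<omega> \<in> space M. \<forall>k\<ge>m. \<omega> \<notin> A k}" for m
  have Bm: "B m \<in> events" for m
    unfolding B_def using A by measurable
  have "prob (B m) \<le> 2 * \<epsilon>" if \<epsilon>: "\<epsilon> > 0" for m and \<epsilon> :: real
  proof -
    from quasi[OF \<epsilon>] obtain K0 where
      K0: "\<And>j k. \<lbrakk>j \<ge> K0; k \<ge> j + l\<rbrakk> \<Longrightarrow> prob (A j \<inter> A k) \<le> (1 + \<epsilon>) * (prob (A j) * prob (A k))"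
      by blast
    define K where "K = max m K0"
    have "\<not> summable (\<lambda>k. prob (A (k + K)))"
      using div by (simp add: summable_iff_shift[of "\<lambda>k. prob (A k)"])
    \<comment> \<open>This threshold makes the near-diagonal contribution
      \<open>(2 * real l + 1) * s\<close> at most \<open>\<epsilon> * s\<^sup>2\<close>.\<close>
    then obtain n where n: "(\<Sum>k<n. prob (A (k + K))) > (2 * real l + 1) / \<epsilon>"
      using summableI_nonneg_bounded[of "\<lambda>k. prob (A (k + K))" "(2 * real l + 1) / \<epsilon>"]
      by (meson measure_nonneg not_le)
    define s where "s = (\<Sum>k<n. prob (A (k + K)))"
    \<comment> \<open>Near the diagonal, the trivial bound of the intersection by
      \<open>A (j + K)\<close> replaces quasi-independence. Truncation of \<open>j - l\<close> only
      shrinks the band, so each row still has at most \<open>2 * l + 1\<close> entries.\<close>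
    define D where "D j k = (if k \<in> {j-l..j+l} then prob (A (j + K)) else 0)" for j k :: nat
    have s_gt: "s > (2 * real l + 1) / \<epsilon>" using n by (simp add: s_def)
    have "(2 * real l + 1) / \<epsilon> > 0" using \<epsilon> by (intro divide_pos_pos) auto
    with s_gt have s_pos: "s > 0" by linarith
    have pair: "prob (A (j+K) \<inter> A (k+K)) \<le> (1 + \<epsilon>) * (prob (A (j+K)) * prob (A (k+K))) + D j k" for j k
    proof (cases "k \<in> {j-l..j+l}")
      case True
      have "prob (A (j+K) \<inter> A (k+K)) \<le> prob (A (j+K))" using A by (intro finite_measure_mono) auto
      moreover have "0 \<le> (1 + \<epsilon>) * (prob (A (j+K)) * prob (A (k+K)))" using \<epsilon> by simp
      ultimately show ?thesis using True unfolding D_def by simp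
    next
      case False
      then consider "k \<ge> j + l" | "j \<ge> k + l" by fastforce
      then show ?thesis
      proof cases
        case 1
        then show ?thesis using K0[of "j+K" "k+K"] False by (simp add: K_def D_def)
      next
        case 2
        then show ?thesis using K0[of "k+K" "j+K"] False
          by (simp add: K_def D_def Int_commute mult.commute)
      qed
    qed
    have D: "(\<Sum>k<n. D j k) \<le> (2 * real l + 1) * prob (A (j+K))" for j
    proof -
      have "(\<Sum>k<n. D j k) = real (card ({..<n} \<inter> {j-l..j+l})) * prob (A (j+K))"
        unfolding D_def by (subst sum.inter_restrict[symmetric]) auto
      moreover have "card ({..<n} \<inter> {j-l..j+l}) \<le> card {j-l..j+l}" by (intro card_mono) auto
      ultimately show ?thesis
        by (auto intro!: mult_right_mono)
    qed
    have "(\<Sum>j<n. \<Sum>k<n. prob (A (j+K) \<inter> A (k+K)))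
        \<le> (\<Sum>j<n. \<Sum>k<n. (1 + \<epsilon>) * (prob (A (j+K)) * prob (A (k+K))) + D j k)"
      by (intro sum_mono pair)
    also have "\<dots> = (1 + \<epsilon>) * s\<^sup>2 + (\<Sum>j<n. \<Sum>k<n. D j k)"
      unfolding sum.distrib s_def power2_eq_square sum_product
      by (simp only: sum_distrib_left)
    also have "(\<Sum>j<n. \<Sum>k<n. D j k) \<le> (\<Sum>j<n. (2 * real l + 1) * prob (A (j+K)))"
      by (intro sum_mono D)
    also have "\<dots> = (2 * real l + 1) * s" by (simp add: s_def sum_distrib_left)
    also have "(2 * real l + 1) * s \<le> \<epsilon> * s * s"
      using s_gt s_pos \<epsilon> by (intro mult_right_mono) (auto simp: field_simps)
    finally have "(\<Sum>j<n. \<Sum>k<n. prob (A (j+K) \<inter> A (k+K))) \<le> s\<^sup>2 + 2 * \<epsilon> * s\<^sup>2"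
      by (simp add: algebra_simps power2_eq_square)
    then have "s\<^sup>2 * prob {\<omega> \<in> space M. \<forall>k\<in>{..<n}. \<omega> \<notin> A (k+K)} \<le> 2 * \<epsilon> * s\<^sup>2"
      using A by (intro second_moment_avoidance) (auto simp: s_def)
    moreover have "prob (B m) \<le> prob {\<omega> \<in> space M. \<forall>k\<in>{..<n}. \<omega> \<notin> A (k+K)}"
    proof (rule finite_measure_mono)
      show "{\<omega> \<in> space M. \<forall>k\<in>{..<n}. \<omega> \<notin> A (k+K)} \<in> events" using A by measurable
    qed (auto simp: B_def K_def)
    ultimately have "s\<^sup>2 * prob (B m) \<le> s\<^sup>2 * (2 * \<epsilon>)"
      by (smt (verit) mult_left_mono zero_le_power2 mult.commute)
    then show ?thesis using s_pos by simp
  qed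
  then have "prob (B m) \<le> 0" for m
    by (rule_tac field_le_epsilon) (metis add_0 field_sum_of_halves mult_2 half_gt_zero)
  then have "prob (B m) = 0" for m by (simp add: measure_le_0_iff)
  then have "B m \<in> null_sets M" for m
    using Bm by (auto simp: emeasure_eq_measure intro: null_setsI)
  then have "AE \<omega> in M. \<omega> \<notin> B m" for m by (rule AE_not_in)
  then have "AE \<omega> in M. \<forall>m. \<omega> \<notin> B m" by (simp add: AE_all_countable)
  then show ?thesis
    by (rule AE_mp) (auto simp: B_def INFM_nat_le)
qed

end

section \<open>Tails of a positive distribution on the naturals\<close>

locale positive_distribution =
  fixes p :: "nat \<Rightarrow> real"
  assumes p_pos: "\<And>i. p i > 0" and p_sums: "p sums 1"
begin

lemma summable_p: "summable (\<lambda>i. p (n + i))"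
  using p_sums summable_iff_shift[of p n] by (auto simp: sums_iff add.commute)

lemma tail_pos: "tail p n > 0"
  unfolding tail_def by (intro suminf_pos summable_p p_pos)

lemma tail_0: "tail p 0 = 1"
  using p_sums by (simp add: tail_def sums_iff)

lemma tail_eq: "tail p n = 1 - (\<Sum>i<n. p i)"
  using suminf_split_initial_segment[of p n] p_sums
  by (simp add: tail_def sums_iff add.commute)

lemma tail_Suc_less: "tail p (Suc n) < tail p n"
  using p_pos[of n] by (simp add: tail_eq)

lemma tail_strict_antimono: "m < n \<Longrightarrow> tail p n < tail p m"
  using lift_Suc_mono_less[of "\<lambda>n. - tail p n" m n] tail_Suc_less by simp

lemma tail_antimono: "m \<le> n \<Longrightarrow> tail p n \<le> tail p m"
  using tail_strict_antimono[of m n] by (cases "m = n") auto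

lemma tail_le_1: "tail p n \<le> 1"
  using tail_antimono[of 0 n] tail_0 by simp

lemma tail_tendsto_0: "tail p \<longlonglongrightarrow> 0"
proof -
  have "(\<lambda>n. 1 - (\<Sum>i<n. p i)) \<longlonglongrightarrow> 1 - 1"
    using p_sums unfolding sums_def by (intro tendsto_intros)
  then show ?thesis by (simp add: tail_eq[abs_def])
qed

lemma exp_R: "exp (R p n) = 1 / tail p n"
  using tail_pos[of n] by (simp add: R_def exp_minus field_simps)

lemma exp_r_Suc: "exp (r p (Suc n)) = tail p n / tail p (Suc n)"
  by (simp add: r_def exp_diff exp_R)

lemma R_nonneg: "R p n \<ge> 0"
  using tail_pos[of n] tail_le_1[of n] by (simp add: R_def)

lemma a_eqI:
  assumes "tail p k \<ge> 1 / real n" "tail p (Suc k) < 1 / real n"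
  shows "a p n = k"
proof -
  have le: "i \<le> k" if "tail p i \<ge> 1 / real n" for i
  proof (rule ccontr)
    assume "\<not> i \<le> k"
    then have "tail p i \<le> tail p (Suc k)" by (intro tail_antimono) simp
    with that assms(2) show False by linarith
  qed
  have "{k. tail p k \<ge> 1 / real n} \<subseteq> {..k}"
    using le by blast
  then have "finite {k. tail p k \<ge> 1 / real n}"
    by (rule finite_subset) simp
  then show ?thesis
    unfolding a_def by (rule Max_eqI) (use le assms(1) in blast)+
qed

text \<open>The first index \<open>n\<close> with \<open>a n = k\<close> when \<open>k\<close> is large; for small \<open>k\<close> it may already be beyond that range.\<close>

definition N :: "nat \<Rightarrow> nat" where
  "N k = nat \<lceil>1 / tail p k\<rceil>"

lemma N_ge: "real (N k) \<ge> 1 / tail p k"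
  unfolding N_def by (rule real_nat_ceiling_ge)

lemma N_le: "real (N k) \<le> 1 / tail p k + 1"
  using tail_pos[of k] by (simp add: N_def of_nat_nat)

lemma N_pos: "N k > 0"
proof -
  have "0 < 1 / tail p k" using tail_pos[of k] by simp
  also have "\<dots> \<le> real (N k)" by (rule N_ge)
  finally show ?thesis by simp
qed

lemma N_mono: "j \<le> k \<Longrightarrow> N j \<le> N k"
  unfolding N_def using tail_antimono[of j k] tail_pos
  by (intro nat_mono ceiling_mono frac_le) auto

lemma N_at_top: "filterlim N at_top sequentially"
proof -
  have "filterlim (\<lambda>k. inverse (tail p k)) at_top sequentially"
    using tail_tendsto_0 tail_pos by (intro filterlim_inverse_at_top) auto
  then have "filterlim (\<lambda>k. real (N k)) at_top sequentially"
    by (rule filterlim_at_top_mono) (simp add: inverse_eq_divide N_ge)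
  then show ?thesis by (simp add: filterlim_sequentially_iff_filterlim_real)
qed

end

section \<open>Tail asymptotics when \<open>r\<close> increases to infinity\<close>

locale growing_hazard = positive_distribution +
  assumes r_mono: "mono_on {1..} (r p)"
    and r_at_top: "filterlim (r p) at_top sequentially"
begin

text \<open>Up to rounding, the product is \<open>tail p (Suc k) / tail p k\<close>, which is
  \<open>exp (- r p (Suc k))\<close>. Being the expected number of the first \<open>N k\<close>
  variables that exceed \<open>k\<close>, it serves both to identify \<open>a p (N k)\<close> and to
  decouple the events at different times.\<close>

lemma N_tail_Suc_tendsto_0: "(\<lambda>k. real (N k) * tail p (Suc k)) \<longlonglongrightarrow> 0"
proof (rule tendsto_sandwich)
  show "\<forall>\<^sub>F k in sequentially. 0 \<le> real (N k) * tail p (Suc k)"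
    by (intro always_eventually allI mult_nonneg_nonneg of_nat_0_le_iff less_imp_le tail_pos)
  have "real (N k) * tail p (Suc k) \<le> exp (- r p (Suc k)) + tail p (Suc k)" for k
  proof -
    have "real (N k) * tail p (Suc k) \<le> (1 / tail p k + 1) * tail p (Suc k)"
      using tail_pos by (intro mult_right_mono N_le less_imp_le)
    also have "\<dots> = exp (- r p (Suc k)) + tail p (Suc k)"
      by (simp add: exp_minus exp_r_Suc distrib_right)
    finally show ?thesis .
  qed
  then show "\<forall>\<^sub>F k in sequentially.
      real (N k) * tail p (Suc k) \<le> exp (- r p (Suc k)) + tail p (Suc k)" by simp
  have "filterlim (\<lambda>k. r p (Suc k)) at_top sequentially"
    using r_at_top by (rule filterlim_compose) (rule filterlim_Suc)
  then have "(\<lambda>k. exp (- r p (Suc k))) \<longlonglongrightarrow> 0"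
    by (rule filterlim_compose[OF exp_at_bot filterlim_compose[OF filterlim_uminus_at_bot_at_top]])
  moreover have "(\<lambda>k. tail p (Suc k)) \<longlonglongrightarrow> 0"
    using tail_tendsto_0 by (rule LIMSEQ_Suc)
  ultimately show "(\<lambda>k. exp (- r p (Suc k)) + tail p (Suc k)) \<longlonglongrightarrow> 0"
    by (rule tendsto_add_zero)
qed simp

lemma eventually_a_N: "\<forall>\<^sub>F k in sequentially. a p (N k) = k"
proof -
  have "\<forall>\<^sub>F k in sequentially. real (N k) * tail p (Suc k) < 1"
    using N_tail_Suc_tendsto_0 by (rule order_tendstoD) simp
  then show ?thesis
  proof eventually_elim
    case (elim k)
    show ?case
    proof (rule a_eqI)
      show "1 / real (N k) \<le> tail p k"
        using N_ge[of k] N_pos[of k] tail_pos[of k] by (simp add: pos_divide_le_eq mult.commute)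
      show "tail p (Suc k) < 1 / real (N k)"
        using elim N_pos[of k] by (simp add: pos_less_divide_eq mult.commute)
    qed
  qed
qed

text \<open>The difference telescopes into \<open>d\<close> increments of \<open>R\<close>, the last
  of which is the largest by monotonicity.\<close>

lemma R_diff_le: "R p (m + d) - R p m \<le> real d * r p (m + d)"
proof (induction d)
  case (Suc d)
  have "real d * r p (m + d) \<le> real d * r p (m + Suc d)"
    \<comment> \<open>For \<open>d = 0\<close> the index \<open>m + d\<close> may be
      \<open>0\<close>, outside the range of \<open>r_mono\<close>, but then the factor
      \<open>real d\<close> vanishes.\<close>
    using mono_onD[OF r_mono, of "m + d" "m + Suc d"] by (cases "d = 0") (auto intro: mult_left_mono)
  moreover have "R p (m + Suc d) - R p (m + d) = r p (m + Suc d)"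
    by (simp add: r_def)
  ultimately show ?case using Suc.IH by (simp add: algebra_simps)
qed simp

text \<open>Past some \<open>i\<close> every step adds at least \<open>2\<close> to
  \<open>R\<close>. This slope makes up for the first \<open>i\<close> indices once \<open>k\<close>
  reaches \<open>2 * i\<close>.\<close>

lemma eventually_R_ge: "\<forall>\<^sub>F k in sequentially. real k \<le> R p k"
proof -
  from r_at_top have "\<forall>\<^sub>F k in sequentially. r p k \<ge> 2"
    by (simp add: filterlim_at_top)
  then obtain i where i: "\<And>k. k \<ge> i \<Longrightarrow> r p k \<ge> 2"
    by (auto simp: eventually_sequentially)
  have R: "R p (i + d) \<ge> 2 * real d" for d
  proof (induction d)
    case (Suc d)
    then show ?case using i[of "Suc (i + d)"] by (simp add: r_def)
  qed (simp add: R_nonneg)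
  have "real k \<le> R p k" if "k \<ge> 2 * i" for k
    using R[of "k - i"] that by simp
  then show ?thesis by (auto simp: eventually_sequentially)
qed

text \<open>With \<open>v = tail p (Suc (k - l))\<close>, the power is roughly
  \<open>exp (- N k * v)\<close>, and \<open>N k * v\<close> is roughly
  \<open>exp (R p k - R p (Suc (k - l)))\<close>, a difference over \<open>l - 1\<close> steps. The
  factor \<open>exp (- 4)\<close> absorbs the rounding in \<open>N k\<close> and the second-order
  term of the logarithm.\<close>

lemma eventually_power_lower_bound:
  assumes l: "l \<ge> 1" and r_lin: "(\<lambda>n. r p n / real n) \<longlonglongrightarrow> 0"
  shows "\<forall>\<^sub>F k in sequentially.
    exp (- 4) * exp (- exp ((real l - 1) * r p k)) \<le> (1 - tail p (Suc (k - l))) ^ N k"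
proof -
  have "(\<lambda>n. (real l - 1) * (r p n / real n)) \<longlonglongrightarrow> (real l - 1) * 0"
    by (intro tendsto_intros r_lin)
  then have "\<forall>\<^sub>F k in sequentially. (real l - 1) * (r p k / real k) < 1/2"
    by (rule order_tendstoD) simp
  moreover have shift: "filterlim (\<lambda>k. Suc (k - l)) sequentially sequentially"
    by (rule filterlim_compose[OF filterlim_Suc filterlim_minus_const_nat_at_top])
  then have "\<forall>\<^sub>F k in sequentially. real (Suc (k - l)) \<le> R p (Suc (k - l))"
    using eventually_R_ge by (auto simp: filterlim_iff)
  moreover have "(\<lambda>k. tail p (Suc (k - l))) \<longlonglongrightarrow> 0"
    using tail_tendsto_0 shift by (rule filterlim_compose)
  \<comment> \<open>Up to \<open>1/2\<close> the quadratic lower bound for \<open>ln (1 - v)\<close>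
    used below is valid.\<close>
  then have "\<forall>\<^sub>F k in sequentially. tail p (Suc (k - l)) < 1/2"
    by (rule order_tendstoD) simp
  moreover have "\<forall>\<^sub>F k in sequentially. k \<ge> 2 * l" by (rule eventually_ge_at_top)
  ultimately show ?thesis
  proof eventually_elim
    case (elim k)
    define m where "m = Suc (k - l)"
    define v where "v = tail p m"
    define E where "E = exp ((real l - 1) * r p k)"
    have v: "0 < v" "v < 1/2" using elim tail_pos by (auto simp: v_def m_def)
    have k: "k = m + (l - 1)" "k > 0" using elim l by (auto simp: m_def)
    have "v / tail p k = exp (R p k - R p m)"
      using tail_pos[of k] tail_pos[of m] by (simp add: exp_diff exp_R v_def field_simps)
    also have "\<dots> \<le> E"
      using R_diff_le[of m "l - 1"] l k by (simp add: E_def of_nat_diff)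
    finally have 1: "v / tail p k \<le> E" .
    \<comment> \<open>the second-order term of \<open>ln (1 - v)\<close>, multiplied by \<open>N k\<close>, stays bounded since \<open>r k = o(k)\<close> and \<open>R m \<ge> m\<close>\<close>
    have "(real l - 1) * r p k \<le> real k / 2"
      using elim(1) k by (simp add: field_simps)
    also have "\<dots> \<le> real m" using elim(4) by (simp add: m_def)
    also have "\<dots> \<le> R p m" using elim(2) by (simp add: m_def)
    finally have "E \<le> 1 / v" by (simp add: E_def v_def exp_R[symmetric])
    then have 2: "E * v \<le> 1" using v by (simp add: field_simps)
    have "real (N k) * (v + 2 * v\<^sup>2) \<le> (1 / tail p k + 1) * (v + 2 * v\<^sup>2)"
      using v N_le by (intro mult_right_mono) auto
    also have "\<dots> = v / tail p k + 2 * (v / tail p k) * v + (v + 2 * v * v)"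
      by (simp add: algebra_simps power2_eq_square)
    also have "\<dots> \<le> E + 2 * E * v + (1 + 1)"
    proof -
      have "v * v \<le> 1/2 * (1/2)" using v by (intro mult_mono) auto
      then have "v + 2 * v * v \<le> 1 + 1" using v by linarith
      moreover have "2 * (v / tail p k) * v \<le> 2 * E * v"
        using v 1 by (intro mult_right_mono) auto
      ultimately show ?thesis using 1 by linarith
    qed
    also have "\<dots> \<le> E + 4" using 2 by simp
    finally have 3: "real (N k) * (v + 2 * v\<^sup>2) \<le> E + 4" .
    have "exp (- 4) * exp (- E) = exp (- (E + 4))" by (simp add: exp_add[symmetric])
    also have "\<dots> \<le> exp (real (N k) * (- v - 2 * v\<^sup>2))"
      using 3 by (simp add: algebra_simps)
    also have "\<dots> = exp (- v - 2 * v\<^sup>2) ^ N k" by (simp add: exp_of_nat_mult)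
    also have "\<dots> \<le> (1 - v) ^ N k"
    proof (rule power_mono)
      have "- v - 2 * v\<^sup>2 \<le> ln (1 - v)"
        using v by (intro ln_one_minus_pos_lower_bound) auto
      then show "exp (- v - 2 * v\<^sup>2) \<le> 1 - v" using v by (simp add: ln_ge_iff)
    qed simp
    finally show ?case by (simp add: E_def v_def m_def)
  qed
qed

text \<open>For \<open>u = tail p (k - l)\<close> and \<open>v = tail p (Suc (k - l))\<close> the
  ratio of the powers is at most \<open>exp (- N k * (u - v))\<close>. Since
  \<open>N k \<ge> 1 / v\<close>, the exponent is at least
  \<open>u / v - 1 = exp (r p (Suc (k - l))) - 1\<close> in absolute value, which tends to
  infinity.\<close>

lemma eventually_lower_level_negligible:
  assumes "l \<ge> 1" and "\<delta> > 0"
  shows "\<forall>\<^sub>F k in sequentially.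
    (1 - tail p (k - l)) ^ N k \<le> \<delta> * (1 - tail p (Suc (k - l))) ^ N k"
proof -
  have shift: "filterlim (\<lambda>k. Suc (k - l)) sequentially sequentially"
    by (rule filterlim_compose[OF filterlim_Suc filterlim_minus_const_nat_at_top])
  have "filterlim (\<lambda>k. r p (Suc (k - l))) at_top sequentially"
    using r_at_top shift by (rule filterlim_compose)
  then have "\<forall>\<^sub>F k in sequentially. r p (Suc (k - l)) \<ge> ln (1 + \<bar>ln \<delta>\<bar>)"
    by (simp add: filterlim_at_top)
  moreover have "\<forall>\<^sub>F k in sequentially. k \<ge> l" by (rule eventually_ge_at_top)
  ultimately show ?thesis
  proof eventually_elim
    case (elim k)
    define u where "u = tail p (k - l)"
    define v where "v = tail p (Suc (k - l))"
    have v: "0 < v" "v < u" "u \<le> 1"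
      by (auto simp: u_def v_def tail_pos tail_le_1 tail_Suc_less)
    have "1 + \<bar>ln \<delta>\<bar> \<le> exp (r p (Suc (k - l)))"
      using elim(1) exp_le_cancel_iff[of "ln (1 + \<bar>ln \<delta>\<bar>)" "r p (Suc (k - l))"] by simp
    then have "\<bar>ln \<delta>\<bar> \<le> (u - v) / v"
      using v by (simp add: exp_r_Suc u_def v_def diff_divide_distrib)
    also have "\<dots> \<le> real (N k) * (u - v)"
    proof -
      have "tail p k \<le> v" using elim(2) assms(1) by (auto simp: v_def intro!: tail_antimono)
      then have "1 / v \<le> 1 / tail p k" using tail_pos[of k] by (intro frac_le) auto
      also have "\<dots> \<le> real (N k)" by (rule N_ge)
      finally have "1 / v * (u - v) \<le> real (N k) * (u - v)" using v by (intro mult_right_mono) auto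
      then show ?thesis by simp
    qed
    finally have N: "- (real (N k) * (u - v)) \<le> ln \<delta>" by linarith
    have "1 - u \<le> (1 - (u - v)) * (1 - v)"
      using mult_nonneg_nonneg[of "u - v" v] v by (simp add: algebra_simps)
    also have "\<dots> \<le> exp (- (u - v)) * (1 - v)"
      using v exp_ge_add_one_self[of "- (u - v)"] by (intro mult_right_mono) linarith+
    finally have "(1 - u) ^ N k \<le> (exp (- (u - v)) * (1 - v)) ^ N k"
      using v by (intro power_mono) auto
    also have "\<dots> = exp (- (real (N k) * (u - v))) * (1 - v) ^ N k"
      by (simp only: power_mult_distrib exp_of_nat_mult[symmetric] mult_minus_right)
    also have "\<dots> \<le> exp (ln \<delta>) * (1 - v) ^ N k"
      using N v by (intro mult_right_mono) auto
    finally show ?case using assms(2) by (simp add: u_def v_def)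
  qed
qed

end

section \<open>The maximum of an i.i.d. sample\<close>

lemma measurable_running_max:
  assumes "\<And>i. i \<ge> 1 \<Longrightarrow> \<xi> i \<in> measurable M (count_space UNIV)"
  shows "running_max \<xi> n \<in> measurable M (count_space UNIV)"
proof -
  have "(\<lambda>\<omega>. Max ((\<lambda>i. \<xi> i \<omega>) ` {1..n})) \<in> measurable M (count_space UNIV)"
  proof (induction n)
    case (Suc n)
    have \<xi>: "\<xi> (Suc n) \<in> measurable M (count_space UNIV)" by (rule assms) simp
    show ?case
    \<comment> \<open>The recursion for \<open>Max\<close> needs a nonempty index set; at
      \<open>n = 0\<close> the previous maximum is the unspecified constant
      \<open>Max {}\<close>.\<close>
    proof (cases "n = 0")
      case True
      then show ?thesis using \<xi> by simp
    next
      case False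
      then have "Max ((\<lambda>i. \<xi> i \<omega>) ` {1..Suc n}) = max (\<xi> (Suc n) \<omega>) (Max ((\<lambda>i. \<xi> i \<omega>) ` {1..n}))" for \<omega>
        by (simp add: atLeastAtMostSuc_conv)
      moreover have "(\<lambda>\<omega>. max (\<xi> (Suc n) \<omega>) (Max ((\<lambda>i. \<xi> i \<omega>) ` {1..n}))) \<in> measurable M (count_space UNIV)"
        \<comment> \<open>As \<open>\<xi> (Suc n)\<close> has countably many values, it may be
          fixed, leaving a function of the previous maximum only.\<close>
        by (rule measurable_compose_countable[OF _ \<xi>]) (rule measurable_compose[OF Suc.IH], simp)
      ultimately show ?thesis by simp
    qed
  qed simp
  then show ?thesis unfolding running_max_def[abs_def] .
qed

locale positive_iid_sequence = prob_space M + positive_distribution p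
  for M :: "'a measure" and p :: "nat \<Rightarrow> real" +
  fixes \<xi> :: "nat \<Rightarrow> 'a \<Rightarrow> nat"
  assumes indep: "indep_vars (\<lambda>_. count_space UNIV) \<xi> {1..}"
    and dist: "\<And>n i. n \<ge> 1 \<Longrightarrow> prob {\<omega> \<in> space M. \<xi> n \<omega> = i} = p i"
begin

lemma \<xi>_measurable: "n \<ge> 1 \<Longrightarrow> \<xi> n \<in> measurable M (count_space UNIV)"
  using indep by (simp add: indep_vars_def)

lemma prob_less:
  assumes "n \<ge> 1"
  shows "prob {\<omega> \<in> space M. \<xi> n \<omega> < m} = 1 - tail p m"
proof -
  note [measurable] = \<xi>_measurable[OF assms]
  have "prob {\<omega> \<in> space M. \<xi> n \<omega> < m} = (\<Sum>i<m. p i)"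
  proof (induction m)
    case (Suc m)
    have "{\<omega> \<in> space M. \<xi> n \<omega> < Suc m} = {\<omega> \<in> space M. \<xi> n \<omega> < m} \<union> {\<omega> \<in> space M. \<xi> n \<omega> = m}"
      by auto
    moreover have "prob \<dots> = prob {\<omega> \<in> space M. \<xi> n \<omega> < m} + prob {\<omega> \<in> space M. \<xi> n \<omega> = m}"
      by (rule finite_measure_Union) auto
    ultimately show ?case using Suc.IH dist[OF assms] by simp
  qed simp
  then show ?thesis by (simp add: tail_eq)
qed

text \<open>The threshold depends on the index so that constraints on the maxima at two different
  times fit into one product.\<close>

lemma prob_box:
  assumes "finite J" "J \<subseteq> {1..}"
  shows "prob {\<omega> \<in> space M. \<forall>i\<in>J. \<xi> i \<omega> < f i} = (\<Prod>i\<in>J. 1 - tail p (f i))"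
proof (cases "J = {}")
  case False
  have "{\<omega> \<in> space M. \<forall>i\<in>J. \<xi> i \<omega> < f i} = (\<Inter>i\<in>J. \<xi> i -` {..<f i} \<inter> space M)"
    using False by auto
  also have "prob \<dots> = (\<Prod>i\<in>J. prob (\<xi> i -` {..<f i} \<inter> space M))"
    using False assms by (intro indep_varsD[OF indep]) auto
  also have "\<dots> = (\<Prod>i\<in>J. 1 - tail p (f i))"
  proof (rule prod.cong)
    fix i assume "i \<in> J"
    then have "prob {\<omega> \<in> space M. \<xi> i \<omega> < f i} = 1 - tail p (f i)"
      using assms by (intro prob_less) auto
    moreover have "{\<omega> \<in> space M. \<xi> i \<omega> < f i} = \<xi> i -` {..<f i} \<inter> space M" by auto
    ultimately show "prob (\<xi> i -` {..<f i} \<inter> space M) = 1 - tail p (f i)" by simp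
  qed simp
  finally show ?thesis .
qed (simp add: prob_space)

lemma box_event:
  assumes "finite J" "J \<subseteq> {1..}"
  shows "{\<omega> \<in> space M. \<forall>i\<in>J. \<xi> i \<omega> < f i} \<in> events"
proof -
  have "{\<omega> \<in> space M. \<xi> i \<omega> < f i} \<in> events" if "i \<in> J" for i
  proof -
    have [measurable]: "\<xi> i \<in> measurable M (count_space UNIV)"
      using that assms by (intro \<xi>_measurable) auto
    show ?thesis by measurable
  qed
  then show ?thesis using assms(1) by (rule sets.sets_Collect_finite_All)
qed

definition max_less :: "nat \<Rightarrow> nat \<Rightarrow> 'a set" where
  "max_less n m = {\<omega> \<in> space M. \<forall>i\<in>{1..n}. \<xi> i \<omega> < m}"

lemma max_less_event: "max_less n m \<in> events"
  unfolding max_less_def by (rule box_event) auto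

lemma prob_max_less: "prob (max_less n m) = (1 - tail p m) ^ n"
  unfolding max_less_def by (subst prob_box) auto

text \<open>Written as a difference of nested boxes, the event has an explicit probability. It is
  empty for \<open>n = 0\<close>, so the junk value of \<open>running_max\<close> never
  enters.\<close>

definition max_eq :: "nat \<Rightarrow> nat \<Rightarrow> 'a set" where
  "max_eq n m = max_less n (Suc m) - max_less n m"

lemma max_eq_event: "max_eq n m \<in> events"
  unfolding max_eq_def by (intro sets.Diff max_less_event)

lemma prob_max_eq: "prob (max_eq n m) = (1 - tail p (Suc m)) ^ n - (1 - tail p m) ^ n"
proof -
  have "max_less n m \<subseteq> max_less n (Suc m)" by (auto simp: max_less_def less_Suc_eq)
  then show ?thesis
    unfolding max_eq_def by (subst finite_measure_Diff) (auto simp: max_less_event prob_max_less)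
qed

lemma running_max_eq:
  assumes "\<omega> \<in> max_eq n m"
  shows "running_max \<xi> n \<omega> = m"
proof -
  have le: "\<xi> i \<omega> \<le> m" if "i \<in> {1..n}" for i
    using assms that by (auto simp: max_eq_def max_less_def less_Suc_eq_le)
  obtain i where i: "i \<in> {1..n}" "\<xi> i \<omega> \<ge> m"
    using assms by (auto simp: max_eq_def max_less_def not_less)
  then have "\<xi> i \<omega> = m" using le[of i] by simp
  then show ?thesis
    unfolding running_max_def using le i by (intro Max_eqI) auto
qed

text \<open>Only the upper bound \<open>m'\<close> on the second maximum is kept, and only for the variables that
  do not enter the first one; these are independent of the first event.\<close>

lemma prob_max_eq_Int_le:
  assumes "n \<le> n'"
  shows "prob (max_eq n m \<inter> max_eq n' m') \<le> prob (max_eq n m) * (1 - tail p (Suc m')) ^ (n' - n)"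
proof -
  \<comment> \<open>In \<open>B (Suc m) - B m\<close> the first \<open>n\<close> variables have
    maximum \<open>m\<close> and the later ones are at most \<open>m'\<close>; independence turns
    this into the product claimed.\<close>
  define B where "B x = {\<omega> \<in> space M. \<forall>i\<in>{1..n'}. \<xi> i \<omega> < (if i \<le> n then x else Suc m')}" for x
  have B: "B x \<in> events" for x unfolding B_def by (rule box_event) auto
  have PB: "prob (B x) = (1 - tail p x) ^ n * (1 - tail p (Suc m')) ^ (n' - n)" for x
  proof -
    have "{1..n'} = {1..n} \<union> {n<..n'}" using assms by auto
    then have "(\<Prod>i\<in>{1..n'}. 1 - tail p (if i \<le> n then x else Suc m'))
        = (\<Prod>i\<in>{1..n}. 1 - tail p (if i \<le> n then x else Suc m'))
          * (\<Prod>i\<in>{n<..n'}. 1 - tail p (if i \<le> n then x else Suc m'))"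
      by (simp only:) (rule prod.union_disjoint, auto)
    also have "(\<Prod>i\<in>{1..n}. 1 - tail p (if i \<le> n then x else Suc m')) = (1 - tail p x) ^ n"
      by simp
    also have "(\<Prod>i\<in>{n<..n'}. 1 - tail p (if i \<le> n then x else Suc m'))
        = (1 - tail p (Suc m')) ^ (n' - n)"
      by simp
    finally show ?thesis unfolding B_def by (subst prob_box) auto
  qed
  have "B m \<subseteq> B (Suc m)" unfolding B_def by (auto split: if_splits simp: less_Suc_eq)
  have "max_eq n m \<inter> max_eq n' m' \<subseteq> B (Suc m) - B m"
  proof
    fix \<omega> assume \<omega>: "\<omega> \<in> max_eq n m \<inter> max_eq n' m'"
    then have "\<omega> \<in> B (Suc m)" unfolding max_eq_def max_less_def B_def by auto
    moreover from \<omega> obtain i where "i \<in> {1..n}" "\<not> \<xi> i \<omega> < m"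
      unfolding max_eq_def max_less_def by auto
    then have "\<omega> \<notin> B m" using assms unfolding B_def by force
    ultimately show "\<omega> \<in> B (Suc m) - B m" by simp
  qed
  then have "prob (max_eq n m \<inter> max_eq n' m') \<le> prob (B (Suc m) - B m)"
    using B by (intro finite_measure_mono) auto
  also have "\<dots> = prob (B (Suc m)) - prob (B m)"
    using B \<open>B m \<subseteq> B (Suc m)\<close> by (intro finite_measure_Diff) auto
  also have "\<dots> = prob (max_eq n m) * (1 - tail p (Suc m')) ^ (n' - n)"
    by (simp add: PB prob_max_eq left_diff_distrib)
  finally show ?thesis .
qed

end

section \<open>Probabilities and dependence of the events at the times \<open>N k\<close>\<close>

locale growing_hazard_iid_sequence = positive_iid_sequence M p \<xi> + growing_hazard p
  for M :: "'a measure" and p :: "nat \<Rightarrow> real" and \<xi> :: "nat \<Rightarrow> 'a \<Rightarrow> nat"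
begin

lemma eventually_prob_max_eq_ge:
  assumes "l \<ge> 1" "\<delta> > 0"
  shows "\<forall>\<^sub>F k in sequentially.
    (1 - \<delta>) * (1 - tail p (Suc (k - l))) ^ N k \<le> prob (max_eq (N k) (k - l))"
  using eventually_lower_level_negligible[OF assms]
  by eventually_elim (simp add: prob_max_eq left_diff_distrib)

text \<open>Conditioning on the earlier event costs at most a factor \<open>w ^ N j\<close>, where
  \<open>w\<close> is the probability that one variable is at most \<open>k - l\<close>. This factor
  is close to \<open>1\<close> because \<open>k - l \<ge> j\<close>, and \<open>w ^ N k\<close> is
  close to the probability of the later event.\<close>

lemma max_eq_quasi_independent:
  assumes l: "l \<ge> 1" and \<epsilon>: "\<epsilon> > 0"
  shows "\<exists>K. \<forall>j\<ge>K. \<forall>k\<ge>j+l. prob (max_eq (N j) (j - l) \<inter> max_eq (N k) (k - l))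
    \<le> (1 + \<epsilon>) * (prob (max_eq (N j) (j - l)) * prob (max_eq (N k) (k - l)))"
proof -
  \<comment> \<open>This \<open>\<delta>\<close> solves
    \<open>(1 + \<epsilon>) * (1 - 2 * \<delta>) = 1\<close>. One factor \<open>1 - \<delta>\<close>
    is spent on \<open>w ^ N j\<close>, the other on replacing \<open>w ^ N k\<close> by the
    probability of the later event.\<close>
  define \<delta> where "\<delta> = \<epsilon> / (2 * (1 + \<epsilon>))"
  have \<delta>: "0 < \<delta>" "\<delta> < 1" using \<epsilon> by (auto simp: \<delta>_def field_simps)
  have "(1 + \<epsilon>) * (1 - 2 * \<delta>) = 1" using \<epsilon> by (simp add: \<delta>_def field_simps)
  moreover have "(1 + \<epsilon>) * (1 - 2 * \<delta>) \<le> (1 + \<epsilon>) * (1 - \<delta>)\<^sup>2"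
    using \<epsilon> by (intro mult_left_mono) (auto simp: power2_diff)
  ultimately have \<delta>\<epsilon>: "1 \<le> (1 + \<epsilon>) * (1 - \<delta>)\<^sup>2" by simp
  have "\<forall>\<^sub>F j in sequentially. real (N j) * tail p (Suc j) < \<delta>"
    using N_tail_Suc_tendsto_0 \<delta>(1) by (rule order_tendstoD)
  then obtain K1 where K1: "\<And>j. j \<ge> K1 \<Longrightarrow> real (N j) * tail p (Suc j) < \<delta>"
    by (auto simp: eventually_sequentially)
  from eventually_prob_max_eq_ge[OF l \<delta>(1)] obtain K2 where K2: "\<And>k. k \<ge> K2 \<Longrightarrow>
      (1 - \<delta>) * (1 - tail p (Suc (k - l))) ^ N k \<le> prob (max_eq (N k) (k - l))"
    by (auto simp: eventually_sequentially)
  have "prob (max_eq (N j) (j - l) \<inter> max_eq (N k) (k - l))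
    \<le> (1 + \<epsilon>) * (prob (max_eq (N j) (j - l)) * prob (max_eq (N k) (k - l)))"
    if j: "j \<ge> max K1 K2" and k: "k \<ge> j + l" for j k
  proof -
    define w where "w = 1 - tail p (Suc (k - l))"
    have w: "0 \<le> w" "w \<le> 1" using tail_le_1 tail_pos by (auto simp: w_def less_imp_le)
    have N: "N j \<le> N k" using k by (intro N_mono) simp
    have "real (N j) * tail p (Suc (k - l)) \<le> real (N j) * tail p (Suc j)"
      using k by (intro mult_left_mono tail_antimono) auto
    also have "\<dots> \<le> \<delta>" using K1[of j] j by simp
    finally have "1 - \<delta> \<le> 1 + real (N j) * (- tail p (Suc (k - l)))" by simp
    also have "\<dots> \<le> (1 + - tail p (Suc (k - l))) ^ N j"
      using tail_le_1 by (intro Bernoulli_inequality) simp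
    finally have wj: "1 - \<delta> \<le> w ^ N j" by (simp add: w_def)
    have "w ^ (N k - N j) \<le> ((1 + \<epsilon>) * (1 - \<delta>)\<^sup>2) * w ^ (N k - N j)"
      using mult_right_mono[OF \<delta>\<epsilon>, of "w ^ (N k - N j)"] w by simp
    also have "\<dots> = (1 + \<epsilon>) * (1 - \<delta>) * ((1 - \<delta>) * w ^ (N k - N j))"
      by (simp add: power2_eq_square mult.assoc)
    also have "\<dots> \<le> (1 + \<epsilon>) * (1 - \<delta>) * (w ^ N j * w ^ (N k - N j))"
      using wj w \<epsilon> \<delta> by (intro mult_left_mono mult_right_mono) auto
    also have "\<dots> = (1 + \<epsilon>) * ((1 - \<delta>) * w ^ N k)"
      using N by (simp add: power_add[symmetric] mult.assoc)
    also have "\<dots> \<le> (1 + \<epsilon>) * prob (max_eq (N k) (k - l))"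
      using K2[of k] j k \<epsilon> by (intro mult_left_mono) (auto simp: w_def)
    finally have wk: "w ^ (N k - N j) \<le> (1 + \<epsilon>) * prob (max_eq (N k) (k - l))" .
    have "prob (max_eq (N j) (j - l) \<inter> max_eq (N k) (k - l))
        \<le> prob (max_eq (N j) (j - l)) * w ^ (N k - N j)"
      unfolding w_def by (rule prob_max_eq_Int_le[OF N])
    also have "\<dots> \<le> prob (max_eq (N j) (j - l)) * ((1 + \<epsilon>) * prob (max_eq (N k) (k - l)))"
      using wk by (intro mult_left_mono) auto
    finally show ?thesis by (simp only: mult_ac)
  qed
  then show ?thesis by blast
qed

lemma not_summable_prob_max_eq:
  assumes l: "l \<ge> 1" and r_lin: "(\<lambda>n. r p n / real n) \<longlonglongrightarrow> 0"
    and div: "\<not> summable (\<lambda>k. exp (- exp ((real l - 1) * r p (Suc k))))"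
  shows "\<not> summable (\<lambda>k. prob (max_eq (N k) (k - l)))"
proof
  assume "summable (\<lambda>k. prob (max_eq (N k) (k - l)))"
  then have sum: "summable (\<lambda>k. 2 * exp 4 * prob (max_eq (N k) (k - l)))"
    by (rule summable_mult)
  \<comment> \<open>Any fixed \<open>\<delta>\<close> below \<open>1\<close> would do in
    \<open>eventually_prob_max_eq_ge\<close>; \<open>1/2\<close> yields the factor \<open>2\<close>
    in the comparison series.\<close>
  have half: "(1/2 :: real) > 0" by simp
  have "\<forall>\<^sub>F k in sequentially. norm (exp (- exp ((real l - 1) * r p k)))
      \<le> 2 * exp 4 * prob (max_eq (N k) (k - l))"
    using eventually_prob_max_eq_ge[OF l half] eventually_power_lower_bound[OF l r_lin]
  proof eventually_elim
    case (elim k)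
    from elim(1) have "(1 - tail p (Suc (k - l))) ^ N k \<le> 2 * prob (max_eq (N k) (k - l))"
      by simp
    with elim(2) have "exp (- 4) * exp (- exp ((real l - 1) * r p k)) \<le> 2 * prob (max_eq (N k) (k - l))"
      by (rule order_trans)
    then have "exp 4 * (exp (- 4) * exp (- exp ((real l - 1) * r p k)))
        \<le> exp 4 * (2 * prob (max_eq (N k) (k - l)))"
      by (rule mult_left_mono) simp
    then show ?case by (simp add: mult.assoc[symmetric] exp_add[symmetric] mult.commute)
  qed
  then have "summable (\<lambda>k. exp (- exp ((real l - 1) * r p k)))"
    by (rule summable_comparison_test_ev) (rule sum)
  then have "summable (\<lambda>k. exp (- exp ((real l - 1) * r p (Suc k))))"
    by (rule iffD2[OF summable_Suc_iff])
  with div show False by contradiction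
qed

lemma AE_running_max_infinitely_often:
  assumes l: "l \<ge> 1" and "(\<lambda>n. r p n / real n) \<longlonglongrightarrow> 0"
    and "\<not> summable (\<lambda>k. exp (- exp ((real l - 1) * r p (Suc k))))"
  shows "AE \<omega> in M. \<exists>\<^sub>\<infinity>n. int (running_max \<xi> n \<omega>) = int (a p n) - int l"
proof -
  have "AE \<omega> in M. \<exists>\<^sub>\<infinity>k. \<omega> \<in> max_eq (N k) (k - l)"
    by (rule quasi_independent_borel_cantelli[where l = l, OF max_eq_event
          not_summable_prob_max_eq[OF assms] max_eq_quasi_independent[OF l]])
  then show ?thesis
  proof eventually_elim
    case (elim \<omega>)
    show ?case unfolding INFM_nat
    proof
      fix n
      have "\<forall>\<^sub>F k in sequentially. n < N k"
        using N_at_top eventually_gt_at_top[of n] by (simp add: filterlim_iff)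
      \<comment> \<open>Unboundedness of \<open>N\<close> turns infinitely many \<open>k\<close>
        into infinitely many times. The condition \<open>k \<ge> l\<close> makes the truncated
        \<open>k - l\<close> agree with the integer difference.\<close>
      then have "\<forall>\<^sub>F k in sequentially. n < N k \<and> a p (N k) = k \<and> k \<ge> l"
        using eventually_a_N eventually_ge_at_top[of l] by eventually_elim simp
      then obtain K where K: "\<And>k. k \<ge> K \<Longrightarrow> n < N k \<and> a p (N k) = k \<and> k \<ge> l"
        by (auto simp: eventually_sequentially)
      from elim obtain k where k: "k \<ge> K" "\<omega> \<in> max_eq (N k) (k - l)"
        by (auto simp: INFM_nat_le)
      then have "int (running_max \<xi> (N k) \<omega>) = int (a p (N k)) - int l"
        using K[OF k(1)] running_max_eq[OF k(2)] by (simp add: of_nat_diff)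
      with K[OF k(1)] show "\<exists>n'>n. int (running_max \<xi> n' \<omega>) = int (a p n') - int l"
        by blast
    qed
  qed
qed

end

theorem theorem3:
  fixes M :: "'a measure"
    and \<xi> :: "nat \<Rightarrow> 'a \<Rightarrow> nat"
    and p :: "nat \<Rightarrow> real"
    and l :: nat
  assumes "prob_space M"
    and "prob_space.indep_vars M (\<lambda>_. count_space UNIV) \<xi> {1..}"
    and "\<And>n i. n \<ge> 1 \<Longrightarrow> measure M {\<omega> \<in> space M. \<xi> n \<omega> = i} = p i"
    and "\<And>i. p i > 0"
    and "p sums 1"
    and "l \<ge> 1"
    and "mono_on {1..} (r p) \<or> antimono_on {1..} (r p)"
    and "filterlim (r p) at_top sequentially"
    and "(\<lambda>n. r p n / real n) \<longlonglongrightarrow> 0"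
    and "\<not> summable (\<lambda>k. exp (- exp ((real l - 1) * r p (Suc k))))"
  shows "measure M {\<omega> \<in> space M.
           \<exists>\<^sub>\<infinity>n. int (running_max \<xi> n \<omega>) = int (a p n) - int l} = 1"
proof -
  interpret prob_space M by fact
  \<comment> \<open>A nonincreasing \<open>r p\<close> would stay below \<open>r p 1\<close> and
    could not tend to infinity.\<close>
  have "mono_on {1..} (r p)"
  proof (rule ccontr)
    assume "\<not> mono_on {1..} (r p)"
    with assms(7) have anti: "antimono_on {1..} (r p)" by blast
    have "\<forall>\<^sub>F n in sequentially. r p 1 < r p n"
      using assms(8) by (simp add: filterlim_at_top_dense)
    then have "\<forall>\<^sub>F n in sequentially. r p 1 < r p n \<and> n \<ge> 1"
      using eventually_ge_at_top[of 1] by (rule eventually_conj)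
    then obtain n where "r p 1 < r p n" "n \<ge> 1"
      by (auto simp: eventually_sequentially)
    moreover have "r p n \<le> r p 1"
      using monotone_onD[OF anti, of 1 n] \<open>n \<ge> 1\<close> by simp
    ultimately show False by simp
  qed
  then interpret growing_hazard_iid_sequence M p \<xi>
    by unfold_locales (use assms in auto)
  have [measurable]: "running_max \<xi> n \<in> measurable M (count_space UNIV)" for n
    by (intro measurable_running_max \<xi>_measurable)
  \<comment> \<open>Measurability allows the almost sure statement to be read as probability
    \<open>1\<close>.\<close>
  have "{\<omega> \<in> space M. \<exists>\<^sub>\<infinity>n. int (running_max \<xi> n \<omega>) = int (a p n) - int l} \<in> events"
    unfolding INFM_nat by measurable
  then show ?thesis
    using AE_running_max_infinitely_often[OF assms(6,9,10)] by (simp add: prob_Collect_eq_1)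
qed

end
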